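(* Consider the $2$-dimensional linear Lie algebras $$\mathfrak{g}_1=\left\{\begin{pmatrix} x&y\\0&0\end{pmatrix} : x,y\in\mathbb{C}\right\}\subset gl(2,\mathbb{C}),\qquad \mathfrak{g}_2=\left\{\begin{pmatrix} x&x&y\\0&x&0\\0&0&0\end{pmatrix} : x,y\in\mathbb{C}\right\}\subset gl(3,\mathbb{C}).$$ Then $\mathfrak{g}_1$ and $\mathfrak{g}_2$ are both rigid, but $\mathfrak{g}_2$ is not algebraic (so $\mathfrak{g}_2$ is a rigid non-algebraic Lie algebra).
   Context: Rigidity: let $\mathcal{L}_n$ be the affine algebraic variety of Lie algebra multiplications (skew-symmetric bilinear maps satisfying the Jacobi identity) on $\mathbb{C}^n$, on which $GL(n,\mathbb{C})$ acts by $\mu_f(X,Y)=f^{-1}(\mu(f(X),f(Y)))$. An $n$-dimensional Lie algebra with multiplication $\mu$ (written in some basis) is rigid if the orbit $\{\mu_f : f\in GL(n,\mathbb{C})\}$ is Zariski open in $\mathcal{L}_n$. Algebraicity: a Lie subalgebra of $gl(m,\mathbb{C})$ is called algebraic if it is the Lie algebra of an algebraic subgroup of $GL(m,\mathbb{C})$. Algebraicity is a property of the embedded linear Lie algebra, not of its isomorphism class as an abstract Lie algebra. *)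

theory Defs
  imports "HOL-Analysis.Analysis"
begin

section \<open>The Zariski topology in given coordinates\<close>

text \<open>
  Polynomial functions in a family \<open>C\<close> of coordinate functions. Over the infinite field of
  complex numbers these are the same thing as polynomials in the coordinates.
\<close>

inductive_set poly_funs :: "('a \<Rightarrow> complex) set \<Rightarrow> ('a \<Rightarrow> complex) set"
  for C :: "('a \<Rightarrow> complex) set" where
  coord: "f \<in> C \<Longrightarrow> f \<in> poly_funs C"
| const: "(\<lambda>_. c) \<in> poly_funs C"
| add: "\<lbrakk>p \<in> poly_funs C; q \<in> poly_funs C\<rbrakk> \<Longrightarrow> (\<lambda>x. p x + q x) \<in> poly_funs C"
| mult: "\<lbrakk>p \<in> poly_funs C; q \<in> poly_funs C\<rbrakk> \<Longrightarrow> (\<lambda>x. p x * q x) \<in> poly_funs C"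

definition zero_locus :: "('a \<Rightarrow> complex) set \<Rightarrow> 'a set" where
  "zero_locus P = {x. \<forall>p\<in>P. p x = 0}"

definition zariski_topology :: "('a \<Rightarrow> complex) set \<Rightarrow> 'a topology" where
  "zariski_topology C = topology (\<lambda>U. \<exists>P\<subseteq>poly_funs C. U = - zero_locus P)"

lemma istopology_zariski: "istopology (\<lambda>U. \<exists>P\<subseteq>poly_funs C. U = - zero_locus P)"
  unfolding istopology_def
proof (intro conjI allI impI)
  fix S T :: "'a set"
  assume "\<exists>P\<subseteq>poly_funs C. S = - zero_locus P" "\<exists>P\<subseteq>poly_funs C. T = - zero_locus P"
  then obtain P Q where P: "P \<subseteq> poly_funs C" "S = - zero_locus P"
    and Q: "Q \<subseteq> poly_funs C" "T = - zero_locus Q" by blast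
  define R where "R = (\<lambda>(p, q) x. p x * q x) ` (P \<times> Q)"
  have "R \<subseteq> poly_funs C" using P(1) Q(1) by (force simp: R_def intro: poly_funs.mult)
  moreover have "S \<inter> T = - zero_locus R"
    unfolding P(2) Q(2) R_def zero_locus_def by simp blast
  ultimately show "\<exists>P\<subseteq>poly_funs C. S \<inter> T = - zero_locus P" by blast
next
  fix K :: "'a set set"
  assume "\<forall>U\<in>K. \<exists>P\<subseteq>poly_funs C. U = - zero_locus P"
  then have "\<exists>F. \<forall>U\<in>K. F U \<subseteq> poly_funs C \<and> U = - zero_locus (F U)"
    by (intro bchoice) blast
  then obtain F where F: "\<And>U. U \<in> K \<Longrightarrow> F U \<subseteq> poly_funs C \<and> U = - zero_locus (F U)"
    by blast
  have "\<Union>K = - zero_locus (\<Union>(F ` K))"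
  proof (rule set_eqI)
    fix x
    have "x \<in> U \<longleftrightarrow> (\<exists>p\<in>F U. p x \<noteq> 0)" if "U \<in> K" for U
    proof -
      have "x \<in> U \<longleftrightarrow> x \<in> - zero_locus (F U)" using F[OF that] by blast
      then show ?thesis unfolding zero_locus_def by blast
    qed
    then show "x \<in> \<Union>K \<longleftrightarrow> x \<in> - zero_locus (\<Union>(F ` K))"
      unfolding zero_locus_def by blast
  qed
  moreover have "\<Union>(F ` K) \<subseteq> poly_funs C" using F by blast
  ultimately show "\<exists>P\<subseteq>poly_funs C. \<Union>K = - zero_locus P" by blast
qed

lemma openin_zariski_topology:
  "openin (zariski_topology C) U \<longleftrightarrow> (\<exists>P\<subseteq>poly_funs C. U = - zero_locus P)"
  unfolding zariski_topology_def by (simp add: topology_inverse'[OF istopology_zariski])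


section \<open>Lie algebra multiplications and rigidity\<close>

definition lie_multiplications ::
    "(complex^'n \<Rightarrow> complex^'n \<Rightarrow> complex^'n) set" where
  "lie_multiplications = {\<mu>.
     (\<forall>X. Vector_Spaces.linear (*s) (*s) (\<mu> X)) \<and>
     (\<forall>Y. Vector_Spaces.linear (*s) (*s) (\<lambda>X. \<mu> X Y)) \<and>
     (\<forall>X Y. \<mu> X Y = - \<mu> Y X) \<and>
     (\<forall>X Y Z. \<mu> X (\<mu> Y Z) + \<mu> Y (\<mu> Z X) + \<mu> Z (\<mu> X Y) = 0)}"

text \<open>
  The structure constants embed the bilinear maps in an affine space. On arbitrary maps they
  do not separate points; the resulting topology is only used on \<open>lie_multiplications\<close>.
\<close>

definition structure_constants ::
    "((complex^'n \<Rightarrow> complex^'n \<Rightarrow> complex^'n) \<Rightarrow> complex) set" where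
  "structure_constants = {\<lambda>\<mu>. \<mu> (axis i 1) (axis j 1) $ k |i j k. True}"

definition lie_variety ::
    "(complex^'n \<Rightarrow> complex^'n \<Rightarrow> complex^'n) topology" where
  "lie_variety = subtopology (zariski_topology structure_constants) lie_multiplications"

definition change_basis ::
    "complex^'n^'n \<Rightarrow> (complex^'n \<Rightarrow> complex^'n \<Rightarrow> complex^'n) \<Rightarrow>
     complex^'n \<Rightarrow> complex^'n \<Rightarrow> complex^'n" where
  "change_basis f \<mu> = (\<lambda>X Y. matrix_inv f *v \<mu> (f *v X) (f *v Y))"

definition rigid_multiplication ::
    "(complex^'n \<Rightarrow> complex^'n \<Rightarrow> complex^'n) \<Rightarrow> bool" where
  "rigid_multiplication \<mu> \<longleftrightarrow>
     \<mu> \<in> lie_multiplications \<and>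
     openin lie_variety {change_basis f \<mu> |f. invertible f}"


section \<open>Linear Lie algebras\<close>

text \<open>
  \<open>*s\<close> on matrices would be a row-wise operation with a vector of scalars, hence a
  separate scalar multiplication.
\<close>

definition mscale :: "complex \<Rightarrow> complex^'m^'m \<Rightarrow> complex^'m^'m" where
  "mscale c A = (\<chi> i j. c * A $ i $ j)"

interpretation gl: vector_space mscale
  by unfold_locales (simp_all add: mscale_def vec_eq_iff algebra_simps)

definition commutator :: "complex^'m^'m \<Rightarrow> complex^'m^'m \<Rightarrow> complex^'m^'m" where
  "commutator A B = A ** B - B ** A"

definition linear_lie_algebra :: "(complex^'m^'m) set \<Rightarrow> bool" where
  "linear_lie_algebra g \<longleftrightarrow> gl.subspace g \<and> (\<forall>A\<in>g. \<forall>B\<in>g. commutator A B \<in> g)"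

definition basis_of :: "('n \<Rightarrow> complex^'m^'m) \<Rightarrow> (complex^'m^'m) set \<Rightarrow> bool" where
  "basis_of b g \<longleftrightarrow> inj b \<and> gl.independent (range b) \<and> gl.span (range b) = g"

definition from_coords :: "('n::finite \<Rightarrow> complex^'m^'m) \<Rightarrow> complex^'n \<Rightarrow> complex^'m^'m" where
  "from_coords b X = (\<Sum>i\<in>UNIV. mscale (X $ i) (b i))"

definition multiplication_in_basis ::
    "('n::finite \<Rightarrow> complex^'m^'m) \<Rightarrow> (complex^'n \<Rightarrow> complex^'n \<Rightarrow> complex^'n) \<Rightarrow> bool" where
  "multiplication_in_basis b \<mu> \<longleftrightarrow>
     (\<forall>X Y. from_coords b (\<mu> X Y) = commutator (from_coords b X) (from_coords b Y))"

text \<open>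
  The type argument fixes the dimension: \<open>g\<close> has a basis indexed by \<open>'n\<close>. The choice of the
  basis is immaterial, since another basis replaces \<open>\<mu>\<close> by an element of the same orbit.
\<close>

definition rigid_lie_algebra :: "'n::finite itself \<Rightarrow> (complex^'m^'m) set \<Rightarrow> bool" where
  "rigid_lie_algebra n g \<longleftrightarrow> linear_lie_algebra g \<and>
     (\<exists>(b :: 'n \<Rightarrow> complex^'m^'m) \<mu>.
        basis_of b g \<and> multiplication_in_basis b \<mu> \<and> rigid_multiplication \<mu>)"


section \<open>Algebraic linear Lie algebras\<close>

definition matrix_entries :: "(complex^'m^'m \<Rightarrow> complex) set" where
  "matrix_entries = {\<lambda>A. A $ i $ j |i j. True}"

definition algebraic_subgroup :: "(complex^'m^'m) set \<Rightarrow> bool" where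
  "algebraic_subgroup G \<longleftrightarrow>
     closedin (subtopology (zariski_topology matrix_entries) {A. invertible A}) G \<and>
     mat 1 \<in> G \<and> (\<forall>A\<in>G. \<forall>B\<in>G. A ** B \<in> G) \<and> (\<forall>A\<in>G. matrix_inv A \<in> G)"

text \<open>
  The Lie algebra is the Zariski tangent space at the identity: all \<open>X\<close> annihilated by the
  differential at the identity of every polynomial vanishing on \<open>G\<close>. As \<open>GL\<close> is a principal
  open subset of the matrix space, the functions involving the inverse determinant impose no
  further condition.
\<close>

definition lie_algebra_of :: "(complex^'m^'m) set \<Rightarrow> (complex^'m^'m) set" where
  "lie_algebra_of G =
     {X. \<forall>p\<in>poly_funs matrix_entries. (\<forall>A\<in>G. p A = 0) \<longrightarrow>
           ((\<lambda>t. p (mat 1 + mscale t X)) has_field_derivative 0) (at 0)}"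

definition algebraic_lie_algebra :: "(complex^'m^'m) set \<Rightarrow> bool" where
  "algebraic_lie_algebra g \<longleftrightarrow> (\<exists>G. algebraic_subgroup G \<and> g = lie_algebra_of G)"


section \<open>The two examples\<close>

definition g1 :: "(complex^2^2) set" where
  "g1 = {vector [vector [x, y],
                 vector [0, 0]] |x y. True}"

definition g2 :: "(complex^3^3) set" where
  "g2 = {vector [vector [x, x, y],
                 vector [0, x, 0],
                 vector [0, 0, 0]] |x y. True}"

end

theory Submission
  imports Defs "HOL-Complex_Analysis.Cauchy_Integral_Formula"
begin

text \<open>
  Both algebras have a basis \<open>A, B\<close> with \<open>[A, B] = B\<close>, so one computation makes both rigid. A
  skew-symmetric bilinear map in dimension two is determined by its value on the two basis vectors:
  every Lie multiplication is \<open>area_bracket v\<close>, a vector \<open>v\<close> times the area form. A change of basis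
  acts on \<open>v\<close> by an invertible linear map, and every nonzero vector can be reached. Hence the orbit
  of a nonabelian multiplication consists of all nonzero ones (\<open>orbit_area_bracket\<close>), and these are
  the ones with some nonvanishing structure constant, an open condition.

  That \<open>g2\<close> is not algebraic is an instance of the fact that algebraic Lie algebras contain the
  semisimple and nilpotent parts of their elements. Suppose that \<open>g2\<close> is the Lie algebra of a
  group \<open>G\<close>. Its element \<open>X = S + N\<close> with \<open>x = 1\<close>, \<open>y = 0\<close> has semisimple part
  \<open>S = diag(1, 1, 0)\<close>, which does not lie in \<open>g2\<close>. The ideal of polynomials vanishing on \<open>G\<close> is
  stable under left translation by \<open>G\<close>, hence under the left-invariant derivation given by \<open>X\<close>.
  For \<open>p\<close> in this ideal all derivatives of the entire function \<open>p (exp (t X))\<close> at \<open>t = 0\<close> are thus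
  values at the identity of elements of the ideal, so the function is zero
  (\<open>ideal_of_group_vanishes_on_flow\<close>). In this way a tangent vector of \<open>G\<close> integrates to a
  one-parameter group on which the ideal of \<open>G\<close> vanishes.

  It remains to separate \<open>S\<close> from \<open>N\<close>. The matrix \<open>exp (t X)\<close> is
  \<open>1 + (e\<^sup>t - 1) S + t e\<^sup>t N\<close>. Adding a multiple of \<open>2 \<pi> \<i>\<close> to \<open>t\<close> moves only the coefficient
  of \<open>N\<close>, so the polynomial \<open>p\<close> has infinitely many zeros on the line in direction \<open>N\<close> and vanishes
  on all of it, in particular at \<open>1 + (e\<^sup>t - 1) S\<close>. So \<open>p\<close> vanishes on the line through the
  identity in direction \<open>S\<close>, and its differential annihilates \<open>S\<close>
  (\<open>semisimple_part_in_lie_algebra\<close>).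
\<close>

section \<open>Lie multiplications on the plane\<close>

definition area_bracket :: "complex^2 \<Rightarrow> complex^2 \<Rightarrow> complex^2 \<Rightarrow> complex^2" where
  "area_bracket v = (\<lambda>X Y. (X $ 1 * Y $ 2 - X $ 2 * Y $ 1) *s v)"

lemma area_bracket_in_lie_multiplications: "area_bracket v \<in> lie_multiplications"
  unfolding lie_multiplications_def mem_Collect_eq
proof (intro conjI allI)
  show "Vector_Spaces.linear (*s) (*s) (area_bracket v X)" for X
    by unfold_locales (simp_all add: area_bracket_def vec_eq_iff algebra_simps)
  show "Vector_Spaces.linear (*s) (*s) (\<lambda>X. area_bracket v X Y)" for Y
    by unfold_locales (simp_all add: area_bracket_def vec_eq_iff algebra_simps)
  show "area_bracket v X Y = - area_bracket v Y X" for X Y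
    by (simp add: area_bracket_def vec_eq_iff algebra_simps)
  show "area_bracket v X (area_bracket v Y Z) + area_bracket v Y (area_bracket v Z X)
      + area_bracket v Z (area_bracket v X Y) = 0" for X Y Z
    by (simp add: area_bracket_def vec_eq_iff algebra_simps)
qed

text \<open>
  Bilinearity reduces \<open>\<mu>\<close> to its values on pairs of basis vectors; skew-symmetry kills the diagonal
  pairs and relates the two others.
\<close>

lemma lie_multiplication_is_area_bracket:
  fixes \<mu> :: "complex^2 \<Rightarrow> complex^2 \<Rightarrow> complex^2"
  assumes "\<mu> \<in> lie_multiplications"
  shows "\<mu> = area_bracket (\<mu> (axis 1 1) (axis 2 1))"
proof (intro ext)
  fix X Y :: "complex^2"
  have linr: "\<And>X. Vector_Spaces.linear (*s) (*s) (\<mu> X)"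
    and linl: "\<And>Y. Vector_Spaces.linear (*s) (*s) (\<lambda>X. \<mu> X Y)"
    and skew: "\<And>X Y. \<mu> X Y = - \<mu> Y X"
    using assms unfolding lie_multiplications_def by blast+
  have add_scale: "\<mu> X (Y + Z) = \<mu> X Y + \<mu> X Z" "\<mu> X (c *s Y) = c *s \<mu> X Y"
    "\<mu> (X + Z) Y = \<mu> X Y + \<mu> Z Y" "\<mu> (c *s X) Y = c *s \<mu> X Y" for X Y Z c
    using vec.linear_add[OF linr] vec.linear_scale[OF linr] vec.linear_add[OF linl] vec.linear_scale[OF linl]
    by blast+
  have self: "\<mu> X X = 0" for X
    using skew[of X X] by (simp add: vec_eq_iff)
  have coords: "Z = Z $ 1 *s axis 1 1 + Z $ 2 *s axis 2 1" for Z :: "complex^2"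
    by (simp add: vec_eq_iff forall_2 axis_def)
  have "\<mu> X Y = \<mu> (X $ 1 *s axis 1 1 + X $ 2 *s axis 2 1) (Y $ 1 *s axis 1 1 + Y $ 2 *s axis 2 1)"
    using coords[of X] coords[of Y] by simp
  also have "\<dots> = (X $ 1 * Y $ 2) *s \<mu> (axis 1 1) (axis 2 1)
      + (X $ 2 * Y $ 1) *s \<mu> (axis 2 1) (axis 1 1)"
    by (simp add: add_scale self vec_eq_iff algebra_simps)
  also have "\<dots> = area_bracket (\<mu> (axis 1 1) (axis 2 1)) X Y"
    by (subst skew[of "axis 2 1"]) (simp add: area_bracket_def vec_eq_iff algebra_simps)
  finally show "\<mu> X Y = area_bracket (\<mu> (axis 1 1) (axis 2 1)) X Y" .
qed

lemma matrix_inv_inverse: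
  assumes "invertible A"
  shows "A ** matrix_inv A = mat 1" "matrix_inv A ** A = mat 1"
  using someI_ex[OF assms[unfolded invertible_def]] unfolding matrix_inv_def by blast+

text \<open>
  The area form is scaled by the determinant, so only the vector is transformed: by the adjugate
  of the base change, as is seen by combining \<open>det f\<close> with the inverse.
\<close>

lemma change_basis_area_bracket:
  fixes f :: "complex^2^2"
  assumes "invertible f"
  shows "change_basis f (area_bracket v) = area_bracket (det f *s (matrix_inv f *v v))"
proof (intro ext)
  fix X Y :: "complex^2"
  have "(f *v X) $ 1 * (f *v Y) $ 2 - (f *v X) $ 2 * (f *v Y) $ 1
      = (X $ 1 * Y $ 2 - X $ 2 * Y $ 1) * det f"
    by (simp add: matrix_vector_mult_def det_2 sum_2 algebra_simps)
  then show "change_basis f (area_bracket v) X Y = area_bracket (det f *s (matrix_inv f *v v)) X Y"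
    by (simp only: change_basis_def area_bracket_def vector_scalar_commute vector_smult_assoc)
qed

lemma orbit_area_bracket:
  "{change_basis f (area_bracket (axis 2 1)) |f. invertible f} = area_bracket ` (- {0})"
proof (intro equalityI subsetI)
  fix \<mu> assume "\<mu> \<in> {change_basis f (area_bracket (axis 2 1)) |f. invertible f}"
  then obtain f :: "complex^2^2" where f: "invertible f"
    and \<mu>: "\<mu> = change_basis f (area_bracket (axis 2 1))" by blast
  have "f *v (matrix_inv f *v axis 2 1) = axis 2 1"
    using f by (simp add: matrix_vector_mul_assoc matrix_inv_inverse)
  then have "matrix_inv f *v axis 2 1 \<noteq> 0"
    by (metis axis_eq_0_iff matrix_vector_mult_0_right zero_neq_one)
  moreover have "det f \<noteq> 0" using f invertible_det_nz by blast
  ultimately show "\<mu> \<in> area_bracket ` (- {0})"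
    using \<mu> change_basis_area_bracket[OF f] by auto
next
  fix \<mu> assume "\<mu> \<in> area_bracket ` (- {0 :: complex^2})"
  then obtain w where w: "w \<noteq> 0" and \<mu>: "\<mu> = area_bracket w" by blast
  have "\<exists>s t. s * w $ 1 + t * w $ 2 = 1"
  proof (cases "w $ 1 = 0")
    case True
    then have "w $ 2 \<noteq> 0" using w by (simp add: vec_eq_iff forall_2)
    then show ?thesis by (intro exI[of _ 0] exI[of _ "1 / w $ 2"]) simp
  next
    case False
    then show ?thesis by (intro exI[of _ "1 / w $ 1"] exI[of _ 0]) simp
  qed
  then obtain s t where st: "s * w $ 1 + t * w $ 2 = 1" by blast
  \<comment> \<open>A matrix of determinant one that sends \<open>w\<close> to the second basis vector: the base change then
      transforms this basis vector back into \<open>w\<close>.\<close>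
  define f :: "complex^2^2" where "f = vector [vector [w $ 2, - w $ 1], vector [s, t]]"
  have det: "det f = 1" using st by (simp add: f_def det_2 algebra_simps)
  then have f: "invertible f" by (simp add: invertible_det_nz)
  have "f *v w = axis 2 1"
    using st by (simp add: f_def vec_eq_iff forall_2 matrix_vector_mult_def sum_2 axis_def algebra_simps)
  then have "matrix_inv f *v axis 2 1 = w"
    using matrix_inv_inverse(2)[OF f] by (metis matrix_vector_mul_assoc matrix_vector_mul_lid)
  then have "change_basis f (area_bracket (axis 2 1)) = \<mu>"
    using change_basis_area_bracket[OF f] \<mu> det by simp
  then show "\<mu> \<in> {change_basis f (area_bracket (axis 2 1)) |f. invertible f}" using f by blast
qed

text \<open>
  A Lie multiplication other than zero has a nonzero structure constant, so the orbit is the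
  complement in the variety of the zero locus of all structure constants.
\<close>

lemma rigid_area_bracket: "rigid_multiplication (area_bracket (axis 2 1))"
proof -
  let ?U = "- zero_locus (structure_constants :: ((complex^2 \<Rightarrow> complex^2 \<Rightarrow> complex^2) \<Rightarrow> complex) set)"
  have U_iff: "\<mu> \<in> ?U \<longleftrightarrow> (\<exists>i j k. \<mu> (axis i 1) (axis j 1) $ k \<noteq> 0)" for \<mu>
    by (auto simp: zero_locus_def structure_constants_def)
  have "area_bracket ` (- {0}) = ?U \<inter> lie_multiplications"
  proof (intro equalityI subsetI)
    fix \<mu> assume "\<mu> \<in> area_bracket ` (- {0 :: complex^2})"
    then obtain w where w: "w \<noteq> 0" and \<mu>: "\<mu> = area_bracket w" by blast
    then obtain k where "w $ k \<noteq> 0" by (auto simp: vec_eq_iff)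
    then have "\<mu> (axis 1 1) (axis 2 1) $ k \<noteq> 0" by (simp add: \<mu> area_bracket_def axis_def)
    then have "\<mu> \<in> ?U" unfolding U_iff by blast
    then show "\<mu> \<in> ?U \<inter> lie_multiplications"
      unfolding \<mu> by (simp add: area_bracket_in_lie_multiplications)
  next
    fix \<mu> assume \<mu>: "\<mu> \<in> ?U \<inter> lie_multiplications"
    define w where "w = \<mu> (axis 1 1) (axis 2 1)"
    have \<mu>_eq: "\<mu> = area_bracket w"
      using \<mu> unfolding w_def by (intro lie_multiplication_is_area_bracket) simp
    obtain i j k where "\<mu> (axis i 1) (axis j 1) $ k \<noteq> 0"
      using \<mu> U_iff by blast
    then have "w \<noteq> 0" unfolding \<mu>_eq by (auto simp: area_bracket_def)
    then show "\<mu> \<in> area_bracket ` (- {0})" using \<mu>_eq by blast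
  qed
  moreover have "openin (zariski_topology structure_constants) ?U"
    unfolding openin_zariski_topology by (intro exI[of _ structure_constants] conjI refl subsetI poly_funs.coord)
  ultimately have "openin lie_variety (area_bracket ` (- {0}))"
    unfolding lie_variety_def openin_subtopology by (intro exI conjI)
  then show ?thesis
    unfolding rigid_multiplication_def orbit_area_bracket
    by (intro conjI area_bracket_in_lie_multiplications)
qed

section \<open>Linear Lie algebras spanned by an affine pair\<close>

lemma mscale_matrix_mult: "mscale c A ** B = mscale c (A ** B)"
  by (simp add: mscale_def matrix_matrix_mult_def vec_eq_iff sum_distrib_left mult.assoc)

lemma matrix_mult_mscale: "A ** mscale c B = mscale c (A ** B)"
  by (simp add: mscale_def matrix_matrix_mult_def vec_eq_iff sum_distrib_left mult.left_commute)

lemma matrix_add_rdistrib: "(A + B) ** C = A ** C + B ** C"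
  by (simp add: matrix_matrix_mult_def vec_eq_iff sum.distrib distrib_right)

lemma commutator_combination:
  assumes "commutator A B = B"
  shows "commutator (mscale x A + mscale y B) (mscale x' A + mscale y' B) = mscale (x * y' - y * x') B"
proof -
  have BA: "B ** A = A ** B - B"
    using assms unfolding commutator_def by (simp add: algebra_simps)
  show ?thesis
    unfolding commutator_def
    by (simp add: matrix_add_ldistrib matrix_add_rdistrib mscale_matrix_mult matrix_mult_mscale BA)
       (simp add: mscale_def vec_eq_iff algebra_simps)
qed

lemma gl_span_pair: "gl.span {A, B} = {mscale x A + mscale y B |x y. True}"
proof (intro equalityI subsetI)
  fix Z assume "Z \<in> gl.span {A, B}"
  then obtain x y where "Z - mscale x A = mscale y B"
    by (auto simp: gl.span_insert gl.span_singleton)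
  then have "Z = mscale x A + mscale y B" by (simp add: algebra_simps)
  then show "Z \<in> {mscale x A + mscale y B |x y. True}" by blast
next
  fix Z assume "Z \<in> {mscale x A + mscale y B |x y. True}"
  then show "Z \<in> gl.span {A, B}"
    by (auto simp: gl.span_add gl.span_scale gl.span_base)
qed

text \<open>
  The relation \<open>[A, B] = B\<close> with \<open>B \<noteq> 0\<close> already forces independence, because multiples of \<open>B\<close> commute
  with \<open>B\<close>. In the basis \<open>A, B\<close> the multiplication is the area form times the second basis vector.
\<close>

lemma rigid_span_affine_pair:
  fixes A B :: "complex^'m^'m"
  assumes comm: "commutator A B = B" and nz: "B \<noteq> 0"
  shows "rigid_lie_algebra TYPE(2) (gl.span {A, B})"
proof -
  define b :: "2 \<Rightarrow> complex^'m^'m" where "b i = (if i = 1 then A else B)" for i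
  have range_b: "range b = {A, B}" by (auto simp: b_def UNIV_2)
  have not_mult: "A \<notin> gl.span {B}"
  proof
    assume "A \<in> gl.span {B}"
    then obtain c where "A = mscale c B" by (auto simp: gl.span_singleton)
    then have "commutator A B = 0"
      by (simp add: commutator_def mscale_matrix_mult matrix_mult_mscale)
    then show False using comm nz by simp
  qed
  have "A \<noteq> B" using not_mult gl.span_base by blast
  have "inj b" using \<open>A \<noteq> B\<close> by (auto simp: inj_def b_def forall_2)
  moreover have "gl.independent {A, B}"
    using not_mult nz \<open>A \<noteq> B\<close> by (simp add: gl.independent_insert)
  ultimately have basis: "basis_of b (gl.span {A, B})"
    by (simp add: basis_of_def range_b)
  have coords: "from_coords b X = mscale (X $ 1) A + mscale (X $ 2) B" for X
    by (simp add: from_coords_def sum_2 b_def)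
  have "multiplication_in_basis b (area_bracket (axis 2 1))"
    by (simp add: multiplication_in_basis_def coords commutator_combination[OF comm]
        area_bracket_def axis_def)
  moreover have "linear_lie_algebra (gl.span {A, B})"
    unfolding linear_lie_algebra_def
  proof (intro conjI ballI)
    fix C D assume "C \<in> gl.span {A, B}" "D \<in> gl.span {A, B}"
    then obtain x y x' y' where "C = mscale x A + mscale y B" "D = mscale x' A + mscale y' B"
      unfolding gl_span_pair by blast
    then show "commutator C D \<in> gl.span {A, B}"
      by (simp add: commutator_combination[OF comm] gl.span_scale gl.span_base)
  qed (rule gl.subspace_span)
  ultimately show ?thesis
    unfolding rigid_lie_algebra_def using basis rigid_area_bracket by (intro conjI exI)
qed

section \<open>Integrating a tangent vector of a matrix group\<close>

lemma poly_funs_left_translation: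
  fixes A :: "complex^'m^'m"
  assumes "p \<in> poly_funs matrix_entries"
  shows "(\<lambda>B. p (A ** B)) \<in> poly_funs matrix_entries"
  using assms
proof induction
  case (coord f)
  then obtain i j where f: "f = (\<lambda>A. A $ i $ j)" by (auto simp: matrix_entries_def)
  have entry: "(\<lambda>B :: complex^'m^'m. B $ k $ j) \<in> poly_funs matrix_entries" for k
    by (rule poly_funs.coord) (auto simp: matrix_entries_def)
  have "(\<lambda>B :: complex^'m^'m. \<Sum>k\<in>K. A $ i $ k * B $ k $ j) \<in> poly_funs matrix_entries"
    if "finite K" for K
    using that by induction (simp_all add: poly_funs.intros entry)
  then show ?case by (simp add: f matrix_matrix_mult_def)
qed (simp_all add: poly_funs.intros)

text \<open>
  The condition \<open>\<gamma>' = \<gamma> X\<close> at the single point \<open>t\<close>. Being pointwise, it covers both the curve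
  \<open>exp (t X)\<close>, where it holds everywhere, and the line \<open>A (1 + t X)\<close>, where it holds at \<open>0\<close>.
\<close>

definition flow_at :: "complex^'m^'m \<Rightarrow> (complex \<Rightarrow> complex^'m^'m) \<Rightarrow> complex \<Rightarrow> bool" where
  "flow_at X \<gamma> t \<longleftrightarrow>
     (\<forall>i j. ((\<lambda>s. \<gamma> s $ i $ j) has_field_derivative (\<gamma> t ** X) $ i $ j) (at t))"

text \<open>
  \<open>q\<close> is the image of \<open>p\<close> under the left-invariant vector field of \<open>X\<close>, characterised by the chain
  rule along all curves tangent to that field, which avoids partial derivatives.
\<close>

definition derivative_along_flow ::
    "complex^'m^'m \<Rightarrow> (complex^'m^'m \<Rightarrow> complex) \<Rightarrow> (complex^'m^'m \<Rightarrow> complex) \<Rightarrow> bool" where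
  "derivative_along_flow X p q \<longleftrightarrow>
     (\<forall>\<gamma> t. flow_at X \<gamma> t \<longrightarrow> ((\<lambda>s. p (\<gamma> s)) has_field_derivative q (\<gamma> t)) (at t))"

lemma ex_derivative_along_flow:
  fixes X :: "complex^'m^'m"
  assumes "p \<in> poly_funs matrix_entries"
  shows "\<exists>q\<in>poly_funs matrix_entries. derivative_along_flow X p q"
  using assms
proof induction
  case (coord f)
  then obtain i j where f: "f = (\<lambda>A. A $ i $ j)" by (auto simp: matrix_entries_def)
  have entry: "(\<lambda>B :: complex^'m^'m. B $ i $ k) \<in> poly_funs matrix_entries" for k
    by (rule poly_funs.coord) (auto simp: matrix_entries_def)
  have "(\<lambda>B :: complex^'m^'m. \<Sum>k\<in>K. B $ i $ k * X $ k $ j) \<in> poly_funs matrix_entries"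
    if "finite K" for K
    using that by induction (simp_all add: poly_funs.intros entry)
  then have "(\<lambda>B. (B ** X) $ i $ j) \<in> poly_funs matrix_entries"
    by (simp add: matrix_matrix_mult_def)
  moreover have "derivative_along_flow X f (\<lambda>B. (B ** X) $ i $ j)"
    by (simp add: f derivative_along_flow_def flow_at_def)
  ultimately show ?case by (intro bexI)
next
  case (const c)
  have "derivative_along_flow X (\<lambda>_. c) (\<lambda>_. 0)" by (simp add: derivative_along_flow_def)
  then show ?case by (rule bexI[OF _ poly_funs.const])
next
  case (add p q)
  then obtain p' q' where mem: "p' \<in> poly_funs matrix_entries" "q' \<in> poly_funs matrix_entries"
    and der: "derivative_along_flow X p p'" "derivative_along_flow X q q'"
    by blast
  have "derivative_along_flow X (\<lambda>A. p A + q A) (\<lambda>A. p' A + q' A)"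
    using der by (simp add: derivative_along_flow_def DERIV_add)
  then show ?case by (rule bexI[OF _ poly_funs.add[OF mem]])
next
  case (mult p q)
  then obtain p' q' where mem: "p' \<in> poly_funs matrix_entries" "q' \<in> poly_funs matrix_entries"
    and der: "derivative_along_flow X p p'" "derivative_along_flow X q q'"
    by blast
  have "derivative_along_flow X (\<lambda>A. p A * q A) (\<lambda>A. p' A * q A + q' A * p A)"
    unfolding derivative_along_flow_def
  proof (intro allI impI)
    fix \<gamma> t assume "flow_at X \<gamma> t"
    then show "((\<lambda>s. p (\<gamma> s) * q (\<gamma> s)) has_field_derivative p' (\<gamma> t) * q (\<gamma> t) + q' (\<gamma> t) * p (\<gamma> t)) (at t)"
      using der unfolding derivative_along_flow_def by (intro DERIV_mult) simp_all
  qed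
  moreover have "(\<lambda>A. p' A * q A + q' A * p A) \<in> poly_funs matrix_entries"
    by (intro poly_funs.add poly_funs.mult mem mult.hyps)
  ultimately show ?case by (intro bexI)
qed

text \<open>
  For \<open>A\<close> in \<open>G\<close>, the translate \<open>B \<mapsto> p (A B)\<close> vanishes on \<open>G\<close> as well, so its differential at the
  identity annihilates \<open>X\<close>. This differential is the derivative of \<open>p\<close> at \<open>A\<close> along the invariant
  field.
\<close>

lemma derivative_along_flow_preserves_ideal:
  fixes X :: "complex^'m^'m"
  assumes mult: "\<And>A B. A \<in> G \<Longrightarrow> B \<in> G \<Longrightarrow> A ** B \<in> G"
    and X: "X \<in> lie_algebra_of G"
    and p: "p \<in> poly_funs matrix_entries" and van: "\<And>A. A \<in> G \<Longrightarrow> p A = 0"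
    and q: "derivative_along_flow X p q"
    and A: "A \<in> G"
  shows "q A = 0"
proof -
  have "\<And>p. p \<in> poly_funs matrix_entries \<Longrightarrow> \<forall>B\<in>G. p B = 0 \<Longrightarrow>
      ((\<lambda>t. p (mat 1 + mscale t X)) has_field_derivative 0) (at 0)"
    using X unfolding lie_algebra_of_def by simp
  from this[OF poly_funs_left_translation[OF p, of A]] have "((\<lambda>t. p (A ** (mat 1 + mscale t X))) has_field_derivative 0) (at 0)"
    using mult[OF A] van by simp
  then have "((\<lambda>t. p (A + mscale t (A ** X))) has_field_derivative 0) (at 0)"
    by (simp add: matrix_add_ldistrib matrix_mult_mscale)
  moreover have "flow_at X (\<lambda>t. A + mscale t (A ** X)) 0"
    by (auto simp: flow_at_def mscale_def matrix_add_rdistrib matrix_matrix_mult_def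
        intro!: derivative_eq_intros)
  then have "((\<lambda>t. p (A + mscale t (A ** X))) has_field_derivative q (A + mscale 0 (A ** X))) (at 0)"
    using q unfolding derivative_along_flow_def by (elim allE impE)
  ultimately have "q (A + mscale 0 (A ** X)) = 0" by (rule DERIV_unique[symmetric])
  then show ?thesis by simp
qed

text \<open>
  The curve \<open>\<gamma>\<close> is \<open>exp (t X)\<close>, specified by its differential equation. Each derivative of \<open>p\<close> along
  it is again an element of the ideal of \<open>G\<close> along it, so the Taylor series at \<open>0\<close> vanishes.
\<close>

lemma ideal_of_group_vanishes_on_flow:
  fixes X :: "complex^'m^'m"
  assumes one: "mat 1 \<in> G" and mult: "\<And>A B. A \<in> G \<Longrightarrow> B \<in> G \<Longrightarrow> A ** B \<in> G"
    and X: "X \<in> lie_algebra_of G"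
    and init: "\<gamma> 0 = mat 1" and flow: "\<And>t. flow_at X \<gamma> t"
    and p: "p \<in> poly_funs matrix_entries" and van: "\<And>A. A \<in> G \<Longrightarrow> p A = 0"
  shows "p (\<gamma> t) = 0"
proof -
  define I where "I = {p \<in> poly_funs matrix_entries. \<forall>A\<in>G. p A = 0}"
  have ex_deriv: "\<exists>q\<in>I. \<forall>t. ((\<lambda>s. p (\<gamma> s)) has_field_derivative q (\<gamma> t)) (at t)"
    if "p \<in> I" for p
  proof -
    have p: "p \<in> poly_funs matrix_entries" and van: "\<And>A. A \<in> G \<Longrightarrow> p A = 0"
      using that by (auto simp: I_def)
    obtain q where q: "q \<in> poly_funs matrix_entries" "derivative_along_flow X p q"
      using ex_derivative_along_flow[OF p] by blast
    have "q A = 0" if "A \<in> G" for A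
      by (rule derivative_along_flow_preserves_ideal[OF mult X p van q(2) that])
    then have "q \<in> I" using q(1) by (simp add: I_def)
    moreover have "\<forall>t. ((\<lambda>s. p (\<gamma> s)) has_field_derivative q (\<gamma> t)) (at t)"
      using q(2) flow unfolding derivative_along_flow_def by simp
    ultimately show ?thesis by (intro bexI)
  qed
  have taylor: "(deriv ^^ n) (\<lambda>s. p (\<gamma> s)) 0 = 0" if "p \<in> I" for n p
    using that
  proof (induction n arbitrary: p)
    case 0
    then show ?case using one init by (simp add: I_def)
  next
    case (Suc n)
    obtain q where q: "q \<in> I"
      and D: "\<And>t. ((\<lambda>s. p (\<gamma> s)) has_field_derivative q (\<gamma> t)) (at t)"
      using ex_deriv[OF Suc.prems] by blast
    have "deriv (\<lambda>s. p (\<gamma> s)) = (\<lambda>s. q (\<gamma> s))"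
      by (rule ext) (rule DERIV_imp_deriv[OF D])
    then show ?case using Suc.IH[OF q] by (simp add: funpow_Suc_right del: funpow.simps)
  qed
  have "p \<in> I" using p van by (simp add: I_def)
  then have "(\<lambda>s. p (\<gamma> s)) holomorphic_on UNIV"
    using ex_deriv unfolding holomorphic_on_open[OF open_UNIV] by blast
  then show ?thesis
    by (rule holomorphic_fun_eq_0_on_connected[of _ UNIV 0])
       (simp_all add: connected_UNIV taylor \<open>p \<in> I\<close>)
qed

section \<open>The semisimple part of a tangent vector\<close>

lemma poly_fun_on_line:
  fixes A B :: "complex^'m^'m"
  assumes "p \<in> poly_funs matrix_entries"
  shows "\<exists>P. \<forall>c. p (A + mscale c B) = poly P c"
  using assms
proof induction
  case (coord f)
  then obtain i j where f: "f = (\<lambda>A. A $ i $ j)" by (auto simp: matrix_entries_def)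
  show ?case by (rule exI[of _ "[:A $ i $ j, B $ i $ j:]"]) (simp add: f mscale_def)
next
  case (const c)
  show ?case by (rule exI[of _ "[:c:]"]) simp
next
  case (add p q)
  then obtain P Q where "\<forall>c. p (A + mscale c B) = poly P c" "\<forall>c. q (A + mscale c B) = poly Q c"
    by blast
  then show ?case by (intro exI[of _ "P + Q"]) simp
next
  case (mult p q)
  then obtain P Q where "\<forall>c. p (A + mscale c B) = poly P c" "\<forall>c. q (A + mscale c B) = poly Q c"
    by blast
  then show ?case by (intro exI[of _ "P * Q"]) simp
qed

lemma poly_fun_zero_on_line:
  fixes A B :: "complex^'m^'m"
  assumes p: "p \<in> poly_funs matrix_entries"
    and "infinite S" and "\<And>c. c \<in> S \<Longrightarrow> p (A + mscale c B) = 0"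
  shows "p (A + mscale c B) = 0"
proof -
  obtain P where P: "\<And>c. p (A + mscale c B) = poly P c" using poly_fun_on_line[OF p] by blast
  have "S \<subseteq> {c. poly P c = 0}" using assms(3) P by auto
  then have "P = 0" using \<open>infinite S\<close> poly_roots_finite infinite_super by blast
  then show ?thesis using P by simp
qed

text \<open>
  The semisimple factor of \<open>exp (t X)\<close> depends only on \<open>e\<^sup>t\<close>, which is periodic, while the unipotent
  factor \<open>1 + t N\<close> is not. A polynomial relation between \<open>e\<^sup>t\<close> and \<open>t\<close> therefore holds for all values
  of the second argument, so a polynomial vanishing on the one-parameter group vanishes on its
  semisimple factor alone.
\<close>

lemma semisimple_part_in_lie_algebra:
  fixes G :: "(complex^3^3) set"
  assumes one: "mat 1 \<in> G" and mult: "\<And>A B. A \<in> G \<Longrightarrow> B \<in> G \<Longrightarrow> A ** B \<in> G"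
    and X: "vector [vector [1, 1, 0], vector [0, 1, 0], vector [0, 0, 0]] \<in> lie_algebra_of G"
  shows "vector [vector [1, 0, 0], vector [0, 1, 0], vector [0, 0, 0]] \<in> lie_algebra_of G"
proof -
  define S N :: "complex^3^3" where
    "S = vector [vector [1, 0, 0], vector [0, 1, 0], vector [0, 0, 0]]" and
    "N = vector [vector [0, 1, 0], vector [0, 0, 0], vector [0, 0, 0]]"
  have SN: "vector [vector [1, 1, 0], vector [0, 1, 0], vector [0, 0, 0]] = S + N"
    by (simp add: S_def N_def vec_eq_iff forall_3)
  have on_S: "p (mat 1 + mscale c S) = 0"
    if p: "p \<in> poly_funs matrix_entries" and van: "\<forall>A\<in>G. p A = 0" for p c
  proof -
    \<comment> \<open>\<open>\<gamma> t = exp (t (S + N))\<close>: here \<open>S\<close> is idempotent, \<open>N\<close> squares to zero and \<open>S N = N S = N\<close>.\<close>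
    define \<gamma> where "\<gamma> t = mat 1 + mscale (exp t - 1) S + mscale (t * exp t) N" for t
    have on_exp: "p (\<gamma> t) = 0" for t
    proof (rule ideal_of_group_vanishes_on_flow[OF one mult])
      show "S + N \<in> lie_algebra_of G" using X SN by simp
      show "flow_at (S + N) \<gamma> t" for t
        unfolding flow_at_def forall_3 \<gamma>_def
        by (auto simp: mscale_def S_def N_def mat_def matrix_matrix_mult_def sum_3 algebra_simps
            intro!: derivative_eq_intros)
      show "\<gamma> 0 = mat 1" by (simp add: \<gamma>_def mscale_def vec_eq_iff)
    qed (use p van in auto)
    have on_exp_S: "p (mat 1 + mscale (exp t - 1) S) = 0" for t
    proof -
      have "p (mat 1 + mscale (exp t - 1) S + mscale b N) = 0" for b
      proof (rule poly_fun_zero_on_line[OF p])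
        \<comment> \<open>The coefficients of \<open>N\<close> in \<open>\<gamma>\<close> at the points of \<open>t + 2 \<pi> \<i> \<nat>\<close>.\<close>
        let ?f = "\<lambda>n :: nat. (t + 2 * of_nat n * of_real pi * \<i>) * exp t"
        have "inj ?f" by (auto simp: inj_def)
        then show "infinite (range ?f)" using finite_imageD infinite_UNIV_nat by blast
        fix c assume "c \<in> range ?f"
        then obtain n :: nat where c: "c = ?f n" by blast
        have "exp (t + 2 * of_nat n * of_real pi * \<i>) = exp t"
          using exp_plus_2pin[of t "int n"] by (simp add: mult_ac)
        then show "p (mat 1 + mscale (exp t - 1) S + mscale c N) = 0"
          using on_exp[of "t + 2 * of_nat n * of_real pi * \<i>"] c by (simp add: \<gamma>_def)
      qed
      from this[of 0] show ?thesis by (simp add: gl.scale_zero_left)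
    qed
    show "p (mat 1 + mscale c S) = 0"
    proof (rule poly_fun_zero_on_line[OF p])
      \<comment> \<open>The values of \<open>exp t - 1\<close> omit only \<open>-1\<close>.\<close>
      show "infinite (- {-1 :: complex})" by (simp add: infinite_UNIV_char_0)
      fix c :: complex assume "c \<in> - {-1}"
      then have "exp (Ln (1 + c)) = 1 + c" by (intro exp_Ln) (auto simp: add_eq_0_iff)
      then show "p (mat 1 + mscale c S) = 0" using on_exp_S[of "Ln (1 + c)"] by simp
    qed
  qed
  have "((\<lambda>t. p (mat 1 + mscale t S)) has_field_derivative 0) (at 0)"
    if "p \<in> poly_funs matrix_entries" "\<forall>A\<in>G. p A = 0" for p
    by (simp add: on_S[OF that])
  then show ?thesis unfolding lie_algebra_of_def S_def[symmetric] by simp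
qed

section \<open>The two examples\<close>

lemma g1_span:
  "g1 = gl.span {vector [vector [1, 0], vector [0, 0]], vector [vector [0, 1], vector [0, 0]]}"
proof -
  have "vector [vector [x, y], vector [0, 0]]
      = mscale x (vector [vector [1, 0], vector [0, 0]] :: complex^2^2) + mscale y (vector [vector [0, 1], vector [0, 0]]) " for x y :: complex
    by (simp add: mscale_def vec_eq_iff forall_2)
  from this[symmetric] show ?thesis unfolding g1_def gl_span_pair by simp
qed

lemma g2_span:
  "g2 = gl.span {vector [vector [1, 1, 0], vector [0, 1, 0], vector [0, 0, 0]],
                 vector [vector [0, 0, 1], vector [0, 0, 0], vector [0, 0, 0]]}"
proof -
  have "vector [vector [x, x, y], vector [0, x, 0], vector [0, 0, 0]]
      = mscale x (vector [vector [1, 1, 0], vector [0, 1, 0], vector [0, 0, 0]] :: complex^3^3)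
      + mscale y (vector [vector [0, 0, 1], vector [0, 0, 0], vector [0, 0, 0]]) " for x y :: complex
    by (simp add: mscale_def vec_eq_iff forall_3)
  from this[symmetric] show ?thesis unfolding g2_def gl_span_pair by simp
qed

lemma rigid_g1: "rigid_lie_algebra TYPE(2) g1"
  unfolding g1_span
  by (rule rigid_span_affine_pair)
     (simp_all add: commutator_def matrix_matrix_mult_def vec_eq_iff forall_2 sum_2)

lemma rigid_g2: "rigid_lie_algebra TYPE(2) g2"
  unfolding g2_span
  by (rule rigid_span_affine_pair)
     (simp_all add: commutator_def matrix_matrix_mult_def vec_eq_iff forall_3 sum_3)

lemma not_algebraic_g2: "\<not> algebraic_lie_algebra g2"
proof
  assume "algebraic_lie_algebra g2"
  then obtain G where G: "algebraic_subgroup G" "g2 = lie_algebra_of G"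
    unfolding algebraic_lie_algebra_def by blast
  have "vector [vector [1, 1, 0], vector [0, 1, 0], vector [0, 0, 0]] \<in> lie_algebra_of G"
    unfolding G(2)[symmetric] g2_def by blast
  then have "vector [vector [1, 0, 0], vector [0, 1, 0], vector [0, 0, 0]] \<in> g2"
    unfolding G(2) using G(1) semisimple_part_in_lie_algebra[of G] unfolding algebraic_subgroup_def by blast
  then show False unfolding g2_def by (auto simp: vec_eq_iff forall_3)
qed

theorem proposition14:
  shows "rigid_lie_algebra TYPE(2) g1 \<and> rigid_lie_algebra TYPE(2) g2 \<and> \<not> algebraic_lie_algebra g2"
  using rigid_g1 rigid_g2 not_algebraic_g2 by blast

end
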